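(* Let $b$ be a rational number with $b\neq -1$ and let $c=1$. Then the cubic polynomials $P(x)$ and $Q(d)$ (defined in the context) are reducible over $\mathbb{Q}$. Moreover, if $b=\frac{2t}{(t-2)^2-2}$ for some rational $t$, then each of $P$ and $Q$ has three rational roots (counted with multiplicity), these roots can be labelled $x_1,x_2,x_3$ (roots of $P$) and $d_1,d_2,d_3$ (roots of $Q$) so that the auxiliary equations hold, but these six numbers are not all positive, so they do not provide a solution of the perfect cuboid problem (Problem 1.2).
   Context: Let $b,c$ be rational numbers. Put $\Delta=b^2c^4-6b^2c^3+13b^2c^2-12b^2c+4b^2+c^2$ and $N=(bc-1-b)(bc-c-2b)$, and assume $\Delta\,N\neq 0$, so that all the following rational numbers are defined (with $D=b^2c^2+2b^2-3b^2c+c-bc^2+2b$): $E_{11}=-\frac{b(c^2+2-4c)}{D}$, $E_{01}=-\frac{b(c^2+2-2c)}{D}$, $E_{10}=-\frac{b^2c^2+2b^2-3b^2c-c}{D}$; $E_{20}=\frac{b}{2}(bc^2-2c-2b)(2bc^2-c^2-6bc+2+4b)(bc-1-b)^{-2}(bc-c-2b)^{-2}$; $E_{02}=\frac12(28b^2c^2-16b^2c-2c^2-4b^2-b^2c^4+4b^3c^4-12b^3c^3+4bc^3+24b^3c-8bc-2b^4c^4+12b^4c^3-26b^4c^2-8b^2c^3+24b^4c-16b^3-8b^4)(bc-1-b)^{-2}(bc-c-2b)^{-2}$; $E_{21}=\frac{b}{2}(5c^6b-2c^6b^2+52c^5b^2-16c^5b-2c^7b^2+2b^4c^8+142b^4c^6-26b^4c^7-426b^4c^5-61b^3c^6+100b^3c^5+14c^7b^3-c^8b^3-20bc^2-8b^2c^2-16b^2c-128b^2c^4-200b^3c^3+244b^3c^2+32bc^3-112b^3c+768b^4c^4-852b^4c^3+568b^4c^2+104b^2c^3-208b^4c+8c^4-4c^3+16b^3+32b^4-2c^5)\,\Delta^{-1}(bc-1-b)^{-2}(bc-c-2b)^{-2}$;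 $E_{12}=(16b^6+32b^5-6c^5b^2+2c^5b-62b^5c^6+62b^6c^6-180b^6c^5+18b^5c^7-12b^6c^7-2b^5c^8+b^6c^8+248b^5c^2+248b^6c^2-96b^6c+321b^6c^4-180b^5c^3-144b^5c-360b^6c^3+b^4c^8+8b^4c^6-6b^4c^7+18b^4c^5+7b^3c^6+90b^5c^5-14b^3c^5-c^7b^3+17b^2c^4+28b^3c^3-28b^3c^2-4bc^3+8b^3c-57b^4c^4+36b^4c^3+32b^4c^2-12b^2c^3-48b^4c-c^4+16b^4)\,\Delta^{-1}(bc-1-b)^{-2}(bc-c-2b)^{-2}$; $E_{03}=\frac{b}{2}(b^2c^4-5b^2c^3+10b^2c^2-10b^2c+4b^2+2bc+2c^2-bc^3)(2b^2c^4-12b^2c^3+26b^2c^2-24b^2c+8b^2-c^4b+3bc^3-6bc+4b+c^3-2c^2+2c)\,\Delta^{-1}(bc-1-b)^{-2}(bc-c-2b)^{-2}$; $E_{30}=c\,b^2(1-c)(c-2)(bc^2-4bc+2+4b)(2bc^2-c^2-4bc+2b)\,\Delta^{-1}(bc-1-b)^{-2}(bc-c-2b)^{-2}$. Define $P(x)=x^3-E_{10}x^2+E_{20}x-E_{30}$ and $Q(d)=d^3-E_{01}d^2+E_{02}d-E_{03}$. For numbers $x_1,x_2,x_3,d_1,d_2,d_3$ the auxiliary equations are: $x_1x_2d_3+x_2x_3d_1+x_3x_1d_2=E_{21}$, $x_1d_2+d_1x_2+x_2d_3+d_2x_3+x_3d_1+d_3x_1=E_{11}$, $x_1d_2d_3+x_2d_3d_1+x_3d_1d_2=E_{12}$.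 Problem 1.2 (equivalent to finding a perfect cuboid) asks for rational $b,c$ such that $P$ and $Q$ have positive rational roots $x_1,x_2,x_3$ and $d_1,d_2,d_3$ satisfying the auxiliary equations. *)

theory Defs
  imports "HOL-Computational_Algebra.Computational_Algebra"
begin

definition cuboid_Delta :: "rat \<Rightarrow> rat \<Rightarrow> rat" where
  "cuboid_Delta b c =
     b^2 * c^4 - 6 * b^2 * c^3 + 13 * b^2 * c^2 - 12 * b^2 * c + 4 * b^2 + c^2"

definition cuboid_N :: "rat \<Rightarrow> rat \<Rightarrow> rat" where
  "cuboid_N b c =
     (b * c - 1 - b) * (b * c - c - 2 * b)"

text \<open>The next denominator is the expanded form of \<^term>\<open>cuboid_N\<close>, so \<open>cuboid_Delta b c * cuboid_N b c \<noteq> 0\<close>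
  makes all the coefficients below well-defined (no division by zero).\<close>

definition cuboid_D :: "rat \<Rightarrow> rat \<Rightarrow> rat" where
  "cuboid_D b c =
     b^2 * c^2 + 2 * b^2 - 3 * b^2 * c + c - b * c^2 + 2 * b"

definition E11 :: "rat \<Rightarrow> rat \<Rightarrow> rat" where
  "E11 b c =
     - (b * (c^2 + 2 - 4 * c)) / cuboid_D b c"

definition E01 :: "rat \<Rightarrow> rat \<Rightarrow> rat" where
  "E01 b c =
     - (b * (c^2 + 2 - 2 * c)) / cuboid_D b c"

definition E10 :: "rat \<Rightarrow> rat \<Rightarrow> rat" where
  "E10 b c =
     - (b^2 * c^2 + 2 * b^2 - 3 * b^2 * c - c) / cuboid_D b c"

definition E20 :: "rat \<Rightarrow> rat \<Rightarrow> rat" where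
  "E20 b c =
     1/2 * b * (b * c^2 - 2 * c - 2 * b) * (2 * b * c^2 - c^2 - 6 * b * c + 2 + 4 * b)
     / (cuboid_N b c)^2"

definition E02 :: "rat \<Rightarrow> rat \<Rightarrow> rat" where
  "E02 b c =
     1/2 * (28 * b^2 * c^2 - 16 * b^2 * c - 2 * c^2 - 4 * b^2 - b^2 * c^4 + 4 * b^3 * c^4
     - 12 * b^3 * c^3 + 4 * b * c^3 + 24 * b^3 * c - 8 * b * c - 2 * b^4 * c^4 + 12 * b^4 * c^3
     - 26 * b^4 * c^2 - 8 * b^2 * c^3 + 24 * b^4 * c - 16 * b^3 - 8 * b^4) / (cuboid_N b c)^2"

definition E21 :: "rat \<Rightarrow> rat \<Rightarrow> rat" where
  "E21 b c =
     1/2 * b * (5 * c^6 * b - 2 * c^6 * b^2 + 52 * c^5 * b^2 - 16 * c^5 * b - 2 * c^7 * b^2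
     + 2 * b^4 * c^8 + 142 * b^4 * c^6 - 26 * b^4 * c^7 - 426 * b^4 * c^5 - 61 * b^3 * c^6
     + 100 * b^3 * c^5 + 14 * c^7 * b^3 - c^8 * b^3 - 20 * b * c^2 - 8 * b^2 * c^2 - 16 * b^2 * c
     - 128 * b^2 * c^4 - 200 * b^3 * c^3 + 244 * b^3 * c^2 + 32 * b * c^3 - 112 * b^3 * c
     + 768 * b^4 * c^4 - 852 * b^4 * c^3 + 568 * b^4 * c^2 + 104 * b^2 * c^3 - 208 * b^4 * c
     + 8 * c^4 - 4 * c^3 + 16 * b^3 + 32 * b^4 - 2 * c^5) / (cuboid_Delta b c * (cuboid_N b c)^2)"

definition E12 :: "rat \<Rightarrow> rat \<Rightarrow> rat" where
  "E12 b c =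
     (16 * b^6 + 32 * b^5 - 6 * c^5 * b^2 + 2 * c^5 * b - 62 * b^5 * c^6 + 62 * b^6 * c^6
     - 180 * b^6 * c^5 + 18 * b^5 * c^7 - 12 * b^6 * c^7 - 2 * b^5 * c^8 + b^6 * c^8
     + 248 * b^5 * c^2 + 248 * b^6 * c^2 - 96 * b^6 * c + 321 * b^6 * c^4 - 180 * b^5 * c^3
     - 144 * b^5 * c - 360 * b^6 * c^3 + b^4 * c^8 + 8 * b^4 * c^6 - 6 * b^4 * c^7
     + 18 * b^4 * c^5 + 7 * b^3 * c^6 + 90 * b^5 * c^5 - 14 * b^3 * c^5 - c^7 * b^3
     + 17 * b^2 * c^4 + 28 * b^3 * c^3 - 28 * b^3 * c^2 - 4 * b * c^3 + 8 * b^3 * c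
     - 57 * b^4 * c^4 + 36 * b^4 * c^3 + 32 * b^4 * c^2 - 12 * b^2 * c^3 - 48 * b^4 * c - c^4
     + 16 * b^4) / (cuboid_Delta b c * (cuboid_N b c)^2)"

definition E03 :: "rat \<Rightarrow> rat \<Rightarrow> rat" where
  "E03 b c =
     1/2 * b * (b^2 * c^4 - 5 * b^2 * c^3 + 10 * b^2 * c^2 - 10 * b^2 * c + 4 * b^2 + 2 * b * c
     + 2 * c^2 - b * c^3) * (2 * b^2 * c^4 - 12 * b^2 * c^3 + 26 * b^2 * c^2 - 24 * b^2 * c
     + 8 * b^2 - c^4 * b + 3 * b * c^3 - 6 * b * c + 4 * b + c^3 - 2 * c^2 + 2 * c)
     / (cuboid_Delta b c * (cuboid_N b c)^2)"

definition E30 :: "rat \<Rightarrow> rat \<Rightarrow> rat" where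
  "E30 b c =
     c * b^2 * (1 - c) * (c - 2) * (b * c^2 - 4 * b * c + 2 + 4 * b) * (2 * b * c^2 - c^2
     - 4 * b * c + 2 * b) / (cuboid_Delta b c * (cuboid_N b c)^2)"

definition cuboid_P :: "rat \<Rightarrow> rat \<Rightarrow> rat poly" where
  "cuboid_P b c = [:- E30 b c, E20 b c, - E10 b c, 1:]"

definition cuboid_Q :: "rat \<Rightarrow> rat \<Rightarrow> rat poly" where
  "cuboid_Q b c = [:- E03 b c, E02 b c, - E01 b c, 1:]"

definition auxiliary_equations ::
  "rat \<Rightarrow> rat \<Rightarrow> rat \<Rightarrow> rat \<Rightarrow> rat \<Rightarrow> rat \<Rightarrow> rat \<Rightarrow> rat \<Rightarrow> bool" where
  "auxiliary_equations b c x1 x2 x3 d1 d2 d3 \<longleftrightarrow>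
     x1 * x2 * d3 + x2 * x3 * d1 + x3 * x1 * d2 = E21 b c \<and>
     x1 * d2 + d1 * x2 + x2 * d3 + d2 * x3 + x3 * d1 + d3 * x1 = E11 b c \<and>
     x1 * d2 * d3 + x2 * d3 * d1 + x3 * d1 * d2 = E12 b c"

text \<open>\<open>x1, x2, x3\<close> are the three roots of the monic cubic \<open>p\<close>, listed with multiplicity.\<close>

definition roots_of_monic_cubic :: "rat poly \<Rightarrow> rat \<Rightarrow> rat \<Rightarrow> rat \<Rightarrow> bool" where
  "roots_of_monic_cubic p x1 x2 x3 \<longleftrightarrow> p = [:- x1, 1:] * [:- x2, 1:] * [:- x3, 1:]"

definition all_positive :: "rat \<Rightarrow> rat \<Rightarrow> rat \<Rightarrow> rat \<Rightarrow> rat \<Rightarrow> rat \<Rightarrow> bool" where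
  "all_positive x1 x2 x3 d1 d2 d3 \<longleftrightarrow>
     x1 > 0 \<and> x2 > 0 \<and> x3 > 0 \<and> d1 > 0 \<and> d2 > 0 \<and> d3 > 0"

text \<open>A solution of the problem that is equivalent to the existence of a perfect cuboid.\<close>

definition cuboid_solution ::
  "rat \<Rightarrow> rat \<Rightarrow> rat \<Rightarrow> rat \<Rightarrow> rat \<Rightarrow> rat \<Rightarrow> rat \<Rightarrow> rat \<Rightarrow> bool" where
  "cuboid_solution b c x1 x2 x3 d1 d2 d3 \<longleftrightarrow>
     cuboid_Delta b c * cuboid_N b c \<noteq> 0 \<and>
     roots_of_monic_cubic (cuboid_P b c) x1 x2 x3 \<and>
     roots_of_monic_cubic (cuboid_Q b c) d1 d2 d3 \<and>
     all_positive x1 x2 x3 d1 d2 d3 \<and>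
     auxiliary_equations b c x1 x2 x3 d1 d2 d3"

end

theory Submission
  imports Defs
begin

text \<open>
  At \<open>c = 1\<close> both cubics share the quadratic factor
  \<open>z\<^sup>2 - z / (1 + b) - b (b + 2) / (2 (1 + b)\<^sup>2)\<close>, the cofactors being \<open>x\<close> in \<open>P\<close> and \<open>d + 1\<close> in \<open>Q\<close>.
  Its discriminant is a square exactly when \<open>2 b\<^sup>2 + 4 b + 1\<close> is, and \<open>b = 2 t / ((t - 2)\<^sup>2 - 2)\<close>
  parametrizes this conic. If \<open>r\<close> and \<open>s\<close> are the roots of the quadratic, then \<open>x = (0, r, s)\<close> and
  \<open>d = (-1, s, r)\<close> satisfy the auxiliary equations because \<open>r\<^sup>2 + s\<^sup>2 = 1\<close>; the roots \<open>0\<close> and \<open>-1\<close>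
  preclude positivity.
\<close>

lemma not_irreducible_if_root:
  fixes p :: "'a :: field poly"
  assumes "poly p a = 0" "degree p > 1"
  shows "\<not> irreducible p"
proof
  assume irr: "irreducible p"
  obtain q where q: "p = [:- a, 1:] * q"
    using assms(1) by (auto simp: poly_eq_0_iff_dvd elim: dvdE)
  with assms(2) have "q \<noteq> 0" by auto
  then have "degree p = 1 + degree q"
    unfolding q by (subst degree_mult_eq) auto
  with assms(2) have "\<not> q dvd 1"
    by (simp add: is_unit_iff_degree \<open>q \<noteq> 0\<close>)
  moreover have "\<not> [:- a, 1:] dvd 1"
    by (simp add: is_unit_iff_degree)
  ultimately show False
    using irreducibleD[OF irr q] by blast
qed

text \<open>At \<open>c = 1\<close>, \<open>cuboid_D\<close> and \<open>cuboid_N\<close> both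
  collapse to \<open>1 + b\<close> and \<open>cuboid_Delta\<close> to 1; the factor
  \<open>1 - c\<close> kills \<open>E30\<close>, and the numerator of \<open>E12\<close> becomes
  \<open>- ((1 + b)\<^sup>2)\<close>.\<close>

lemma E_at_one:
  assumes "b \<noteq> - 1"
  shows "E10 b 1 = 1 / (1 + b)"
    and "E01 b 1 = - b / (1 + b)"
    and "E11 b 1 = b / (1 + b)"
    and "E20 b 1 = - (b * (b + 2)) / (2 * (1 + b)\<^sup>2)"
    and "E02 b 1 = - (b\<^sup>2 + 4 * b + 2) / (2 * (1 + b)\<^sup>2)"
    and "E21 b 1 = b * (b + 2) / (2 * (1 + b)\<^sup>2)"
    and "E12 b 1 = - 1"
    and "E03 b 1 = b * (b + 2) / (2 * (1 + b)\<^sup>2)"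
    and "E30 b 1 = 0"
proof -
  have nz: "1 + b \<noteq> 0" using assms by (simp add: add_eq_0_iff2)
  have D: "cuboid_D b 1 = 1 + b" by (simp add: cuboid_D_def)
  have N: "cuboid_N b 1 = 1 + b" by (simp add: cuboid_N_def)
  have Dl: "cuboid_Delta b 1 = 1" by (simp add: cuboid_Delta_def)
  show "E10 b 1 = 1 / (1 + b)" "E01 b 1 = - b / (1 + b)" "E11 b 1 = b / (1 + b)" "E30 b 1 = 0"
    by (simp_all add: E10_def E01_def E11_def E30_def D)
  show "E20 b 1 = - (b * (b + 2)) / (2 * (1 + b)\<^sup>2)"
    using nz by (simp add: E20_def N divide_simps) algebra
  show "E02 b 1 = - (b\<^sup>2 + 4 * b + 2) / (2 * (1 + b)\<^sup>2)"
    using nz by (simp add: E02_def N divide_simps)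
  show "E21 b 1 = b * (b + 2) / (2 * (1 + b)\<^sup>2)"
    using nz by (simp add: E21_def N Dl divide_simps)
  show "E12 b 1 = - 1"
    using nz by (simp add: E12_def N Dl divide_simps) algebra
  show "E03 b 1 = b * (b + 2) / (2 * (1 + b)\<^sup>2)"
    using nz by (simp add: E03_def N Dl divide_simps)
qed

text \<open>The hypotheses on \<open>r\<close> and \<open>s\<close> are Vieta's relations for the
  shared quadratic; this and the next two lemmas use its roots only through them.\<close>

lemma cuboid_P_at_one:
  assumes "b \<noteq> - 1" "r + s = 1 / (1 + b)" "r * s = - (b * (b + 2)) / (2 * (1 + b)\<^sup>2)"
  shows "roots_of_monic_cubic (cuboid_P b 1) 0 r s"
proof -
  have "E10 b 1 = r + s" "E20 b 1 = r * s" "E30 b 1 = 0"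
    unfolding assms(2,3) by (rule E_at_one[OF assms(1)])+
  then show ?thesis
    by (simp add: roots_of_monic_cubic_def cuboid_P_def mult.commute)
qed

lemma cuboid_Q_at_one:
  assumes "b \<noteq> - 1" "r + s = 1 / (1 + b)" "r * s = - (b * (b + 2)) / (2 * (1 + b)\<^sup>2)"
  shows "roots_of_monic_cubic (cuboid_Q b 1) (- 1) s r"
proof -
  have nz: "1 + b \<noteq> 0" using assms(1) by (simp add: add_eq_0_iff2)
  \<comment> \<open>Elementary symmetric functions of \<open>- 1\<close>, \<open>s\<close>,
    \<open>r\<close>.\<close>
  have 1: "E01 b 1 = - 1 + (r + s)" "E03 b 1 = - (r * s)"
    using nz unfolding assms(2,3) by (simp_all add: E_at_one[OF assms(1)] field_simps)
  have 2: "E02 b 1 = r * s - (r + s)"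
    using nz unfolding assms(2,3) E_at_one(5)[OF assms(1)]
    by (simp add: divide_simps) algebra
  show ?thesis
    by (simp add: roots_of_monic_cubic_def cuboid_Q_def 1 2 algebra_simps)
qed

text \<open>Crossing \<open>(s, r)\<close> against \<open>(r, s)\<close> turns the mixed products
  into squares: the left-hand sides become \<open>- (r * s)\<close>,
  \<open>r\<^sup>2 + s\<^sup>2 - (r + s)\<close> and
  \<open>- (r\<^sup>2 + s\<^sup>2)\<close>.\<close>

lemma auxiliary_equations_at_one:
  assumes "b \<noteq> - 1" "r + s = 1 / (1 + b)" "r * s = - (b * (b + 2)) / (2 * (1 + b)\<^sup>2)"
  shows "auxiliary_equations b 1 0 r s (- 1) s r"
proof -
  have nz: "1 + b \<noteq> 0" using assms(1) by (simp add: add_eq_0_iff2)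
  have "r\<^sup>2 + s\<^sup>2 = (r + s)\<^sup>2 - 2 * (r * s)"
    by (simp add: power2_eq_square algebra_simps)
  \<comment> \<open>Both numerator and denominator are \<open>(1 + b)\<^sup>2\<close>, since
    \<open>1 + b * (b + 2) = (1 + b)\<^sup>2\<close>.\<close>
  also have "\<dots> = 1"
    using nz unfolding assms(2,3) by (simp add: divide_simps) algebra
  finally have sq: "r\<^sup>2 + s\<^sup>2 = 1" .
  have "E11 b 1 = 1 - (r + s)" "E21 b 1 = - (r * s)"
    using nz unfolding assms(2,3) by (simp_all add: E_at_one[OF assms(1)] field_simps)
  then show ?thesis
    using sq by (simp add: auxiliary_equations_def E_at_one(7)[OF assms(1)] power2_eq_square)
qed

text \<open>Keeps the denominator \<open>(t - 2)\<^sup>2 - 2\<close> nonzero for every rational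
  \<open>t\<close>.\<close>

lemma square_rat_neq_2: "(x::rat)\<^sup>2 \<noteq> 2"
proof
  assume x: "x\<^sup>2 = 2"
  obtain p q where pq: "quotient_of x = (p, q)" by fastforce
  have "x = of_int p / of_int q" "q > 0" "coprime p q"
    using quotient_of_div[OF pq] quotient_of_denom_pos[OF pq] quotient_of_coprime[OF pq] by auto
  with x have "of_int (p\<^sup>2) = (of_int (2 * q\<^sup>2) :: rat)"
    by (simp add: field_simps)
  then have sq: "p\<^sup>2 = 2 * q\<^sup>2"
    by (simp only: of_int_eq_iff)
  then have "even (p\<^sup>2)" by simp
  then have "even p" by simp
  then obtain k where "p = 2 * k" by blast
  with sq have "q\<^sup>2 = 2 * k\<^sup>2" by (simp add: power_mult_distrib)
  then have "even (q\<^sup>2)" by simp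
  then have "even q" by simp
  with \<open>even p\<close> \<open>coprime p q\<close> show False
    using coprime_common_divisor[of p q 2] by simp
qed

text \<open>The values of \<open>r\<close> and \<open>s\<close> come from the quadratic formula:
  under the parametrization the discriminant is the square of
  \<open>(t\<^sup>2 - 2) / (t\<^sup>2 - 2 * t + 2)\<close>.\<close>

lemma shared_quadratic_roots:
  fixes b t :: rat
  assumes b: "b = 2 * t / ((t - 2)\<^sup>2 - 2)"
  defines "r \<equiv> (t\<^sup>2 - 2 * t) / (t\<^sup>2 - 2 * t + 2)" and "s \<equiv> (2 - 2 * t) / (t\<^sup>2 - 2 * t + 2)"
  shows "r + s = 1 / (1 + b)" and "r * s = - (b * (b + 2)) / (2 * (1 + b)\<^sup>2)"
proof -
  define w m where "w = (t - 2)\<^sup>2 - 2" and "m = t\<^sup>2 - 2 * t + 2"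
  have w: "w \<noteq> 0" using square_rat_neq_2[of "t - 2"] by (simp add: w_def)
  have "m = (t - 1)\<^sup>2 + 1" by (simp add: m_def power2_eq_square algebra_simps)
  then have m: "m \<noteq> 0" using zero_le_power2[of "t - 1"] by linarith
  have b1: "1 + b = m / w" and b2: "b = 2 * t / w"
    using w by (simp_all add: b flip: w_def)
      (simp add: w_def m_def field_simps power2_eq_square)
  show "r + s = 1 / (1 + b)"
    using m by (simp add: b1 r_def s_def flip: m_def)
      (simp add: divide_simps w_def power2_eq_square algebra_simps)
  show "r * s = - (b * (b + 2)) / (2 * (1 + b)\<^sup>2)"
    \<comment> \<open>The order matters: \<open>1 + b\<close> must become \<open>m / w\<close>
      before the remaining \<open>b\<close> is replaced.\<close>
    unfolding b1 unfolding b2 r_def s_def m_def[symmetric]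
    using m w by (simp add: divide_simps) (simp add: w_def m_def power2_eq_square algebra_simps)
qed

theorem theorem4p1:
  fixes b c :: rat
  assumes "b \<noteq> - 1" and "c = 1"
  shows "\<not> irreducible (cuboid_P b c) \<and> \<not> irreducible (cuboid_Q b c) \<and>
    (\<forall>t::rat. b = 2 * t / ((t - 2)^2 - 2) \<longrightarrow>
      (\<exists>x1 x2 x3 d1 d2 d3 :: rat.
         roots_of_monic_cubic (cuboid_P b c) x1 x2 x3 \<and>
         roots_of_monic_cubic (cuboid_Q b c) d1 d2 d3 \<and>
         auxiliary_equations b c x1 x2 x3 d1 d2 d3 \<and>
         \<not> all_positive x1 x2 x3 d1 d2 d3 \<and>
         \<not> cuboid_solution b c x1 x2 x3 d1 d2 d3))"
proof (intro conjI allI impI)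
  \<comment> \<open>Reducibility holds for every \<open>b \<noteq> - 1\<close>, through the root 0
    of \<open>P\<close> and the root \<open>- 1\<close> of \<open>Q\<close>.\<close>
  show "\<not> irreducible (cuboid_P b c)"
    by (rule not_irreducible_if_root[of _ 0])
      (simp_all add: cuboid_P_def E_at_one[OF assms(1)] assms(2))
  have nz: "1 + b \<noteq> 0" using assms(1) by (simp add: add_eq_0_iff2)
  have "poly (cuboid_Q b c) (- 1) = 0"
    using nz by (simp add: cuboid_Q_def E_at_one[OF assms(1)] assms(2) divide_simps) algebra
  then show "\<not> irreducible (cuboid_Q b c)"
    by (rule not_irreducible_if_root) (simp add: cuboid_Q_def)
next
  fix t :: rat
  assume "b = 2 * t / ((t - 2)^2 - 2)"
  from shared_quadratic_roots[OF this] obtain r s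
    where rs: "r + s = 1 / (1 + b)" "r * s = - (b * (b + 2)) / (2 * (1 + b)\<^sup>2)"
    by blast
  have "\<not> all_positive 0 r s (- 1) s r"
    by (simp add: all_positive_def)
  with cuboid_P_at_one[OF assms(1) rs] cuboid_Q_at_one[OF assms(1) rs]
    auxiliary_equations_at_one[OF assms(1) rs]
  show "\<exists>x1 x2 x3 d1 d2 d3 :: rat.
         roots_of_monic_cubic (cuboid_P b c) x1 x2 x3 \<and>
         roots_of_monic_cubic (cuboid_Q b c) d1 d2 d3 \<and>
         auxiliary_equations b c x1 x2 x3 d1 d2 d3 \<and>
         \<not> all_positive x1 x2 x3 d1 d2 d3 \<and>
         \<not> cuboid_solution b c x1 x2 x3 d1 d2 d3"
    unfolding assms(2) cuboid_solution_def by blast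
qed

end
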